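(* Assume that, for each $x$, the support of $A$ given $X=x$ is an open (possibly unbounded) interval. Let $\alpha\in\mathcal{R}$, where $$\mathcal{R}=\left\{\alpha\in\mathcal{H}\;:\;E\{\alpha(A,X)A\}=1,\;E\{\alpha(A,X)\mid X\}=0\right\},$$ and define the weight $$w(a,x)=\frac{F(a|x)\{1-F(a|x)\}}{p_0(a|x)}\Big[E\{\alpha(A,X)\mid A>a,X=x\}-E\{\alpha(A,X)\mid A\le a,X=x\}\Big].$$ Then for all differentiable functions $f\in\mathcal{H}$, $$\langle f,\alpha\rangle=E\{w(A,X)f'(A,X)\}.$$
   Context: $(Y,A,X)$ is a random variable with distribution $P_0$, where $Y\in\mathbb{R}$ is an outcome, $A\in\mathbb{R}$ is a continuous treatment and $X\in\mathbb{R}^p$ is a covariate vector. $p_0(a|x)$ is the conditional density of $A$ given $X=x$ and $F(a|x)$ is the conditional distribution function of $A$ given $X=x$. The support of $A$ given $X=x$ is the set of $a$ with $p_0(a|x)>0$. $\mathcal{H}$ is the Hilbert space of functions $f:\mathbb{R}\times\mathbb{R}^p\to\mathbb{R}$ with inner product $\langle f,g\rangle=E\{f(A,X)g(A,X)\}$ and finite norm $\|f\|=\langle f,f\rangle^{1/2}<\infty$. A superscript prime denotes the derivative with respect to the first argument, and "differentiable" means differentiable with respect to the first argument. Equalities between conditional expectations given $X$ hold almost surely.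
   Formalization: The formal theorem also assumes that E{w(A,X)f'(A,X)} is well defined, possibly infinite, and proves it finite. Without this it can fail to exist: e.g. A standard normal, X constant, α(a,x)=a (so w=1), f(a,x)=sin(exp(a²)). *)

theory Defs
  imports "HOL-Probability.Probability"
begin

text \<open>
  The jointly measurable function \<open>p0\<close> is a version of the conditional density of \<open>A\<close> given
  \<open>X = x\<close>, with respect to Lebesgue measure: every \<open>p0 (\<cdot>|x)\<close> is a probability density, and the
  joint law of \<open>(A, X)\<close> is \<open>p0 a x da P\<^sub>X(dx)\<close>.
\<close>

definition is_cond_density ::
    "'s measure \<Rightarrow> ('s \<Rightarrow> real) \<Rightarrow> ('s \<Rightarrow> real ^ 'p) \<Rightarrow> (real \<Rightarrow> real ^ 'p \<Rightarrow> real) \<Rightarrow> bool" where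
  "is_cond_density M A X p0 \<longleftrightarrow>
     (\<forall>a x. 0 \<le> p0 a x) \<and>
     (\<forall>x. (\<integral>\<^sup>+ a. ennreal (p0 a x) \<partial>lborel) = 1) \<and>
     distributed M (lborel \<Otimes>\<^sub>M distr M borel X) (\<lambda>\<omega>. (A \<omega>, X \<omega>)) (\<lambda>(a, x). ennreal (p0 a x))"

definition cond_law :: "(real \<Rightarrow> real ^ 'p \<Rightarrow> real) \<Rightarrow> real ^ 'p \<Rightarrow> real measure" where
  "cond_law p0 x = density lborel (\<lambda>a. ennreal (p0 a x))"

definition cond_cdf :: "(real \<Rightarrow> real ^ 'p \<Rightarrow> real) \<Rightarrow> real \<Rightarrow> real ^ 'p \<Rightarrow> real" where
  "cond_cdf p0 a x = cdf (cond_law p0 x) a"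

definition cond_support :: "(real \<Rightarrow> real ^ 'p \<Rightarrow> real) \<Rightarrow> real ^ 'p \<Rightarrow> real set" where
  "cond_support p0 x = {a. 0 < p0 a x}"

text \<open>
  \<open>E{g(A, X) | A \<in> B, X = x}\<close>: the mean of \<open>g (\<cdot>, x)\<close> under the conditional law of \<open>A\<close> given
  \<open>X = x\<close>, further conditioned on the event \<open>A \<in> B\<close>. It is only meaningful if that event has
  positive conditional probability, which for \<open>{a<..}\<close> and \<open>{..a}\<close> holds whenever \<open>a\<close> is in an
  open support interval.
\<close>

definition cond_mean_on ::
    "(real \<Rightarrow> real ^ 'p \<Rightarrow> real) \<Rightarrow> (real \<times> (real ^ 'p) \<Rightarrow> real) \<Rightarrow> real set \<Rightarrow> real ^ 'p \<Rightarrow> real" where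
  "cond_mean_on p0 g B x =
     (LINT t:B|cond_law p0 x. g (t, x)) / measure (cond_law p0 x) B"

definition H_space ::
    "'s measure \<Rightarrow> ('s \<Rightarrow> real) \<Rightarrow> ('s \<Rightarrow> real ^ 'p) \<Rightarrow> (real \<times> (real ^ 'p) \<Rightarrow> real) set" where
  "H_space M A X =
     {f. f \<in> borel_measurable borel \<and> integrable M (\<lambda>\<omega>. (f (A \<omega>, X \<omega>))\<^sup>2)}"

definition H_inner ::
    "'s measure \<Rightarrow> ('s \<Rightarrow> real) \<Rightarrow> ('s \<Rightarrow> real ^ 'p) \<Rightarrow>
     (real \<times> (real ^ 'p) \<Rightarrow> real) \<Rightarrow> (real \<times> (real ^ 'p) \<Rightarrow> real) \<Rightarrow> real" where
  "H_inner M A X f g = (\<integral>\<omega>. f (A \<omega>, X \<omega>) * g (A \<omega>, X \<omega>) \<partial>M)"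

definition R_set ::
    "'s measure \<Rightarrow> ('s \<Rightarrow> real) \<Rightarrow> ('s \<Rightarrow> real ^ 'p) \<Rightarrow> (real \<times> (real ^ 'p) \<Rightarrow> real) set" where
  "R_set M A X =
     {\<alpha> \<in> H_space M A X.
        integrable M (\<lambda>\<omega>. \<alpha> (A \<omega>, X \<omega>) * A \<omega>) \<and>
        (\<integral>\<omega>. \<alpha> (A \<omega>, X \<omega>) * A \<omega> \<partial>M) = 1 \<and>
        (AE \<omega> in M.
           real_cond_exp M (vimage_algebra (space M) X borel) (\<lambda>\<omega>. \<alpha> (A \<omega>, X \<omega>)) \<omega> = 0)}"

definition weight ::
    "(real \<Rightarrow> real ^ 'p \<Rightarrow> real) \<Rightarrow> (real \<times> (real ^ 'p) \<Rightarrow> real) \<Rightarrow> real \<Rightarrow> real ^ 'p \<Rightarrow> real" where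
  "weight p0 \<alpha> a x =
     cond_cdf p0 a x * (1 - cond_cdf p0 a x) / p0 a x *
       (cond_mean_on p0 \<alpha> {a<..} x - cond_mean_on p0 \<alpha> {..a} x)"

definition differentiable_fst :: "(real \<times> (real ^ 'p) \<Rightarrow> real) \<Rightarrow> bool" where
  "differentiable_fst f \<longleftrightarrow> (\<forall>a x. (\<lambda>t. f (t, x)) differentiable (at a))"

definition deriv_fst :: "(real \<times> (real ^ 'p) \<Rightarrow> real) \<Rightarrow> real \<Rightarrow> real ^ 'p \<Rightarrow> real" where
  "deriv_fst f a x = deriv (\<lambda>t. f (t, x)) a"

text \<open>
  The expectation of \<open>Z\<close> is well defined, as a possibly infinite number: the positive and the
  negative part of \<open>Z\<close> do not both have infinite expectation. (Negative reals are mapped to \<open>0\<close>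
  by \<open>ennreal\<close>.)
\<close>

definition expectation_exists :: "'s measure \<Rightarrow> ('s \<Rightarrow> real) \<Rightarrow> bool" where
  "expectation_exists M Z \<longleftrightarrow>
     Z \<in> borel_measurable M \<and>
     ((\<integral>\<^sup>+ \<omega>. ennreal (Z \<omega>) \<partial>M) < \<infinity> \<or> (\<integral>\<^sup>+ \<omega>. ennreal (- Z \<omega>) \<partial>M) < \<infinity>)"

end

theory Submission
  imports Defs
begin

text \<open>
  Fix a value \<open>x\<close> of the covariate, let \<open>p\<close> be the conditional density of \<open>A\<close>, \<open>g\<close> the function
  \<open>\<alpha> (\<cdot>, x)\<close> and \<open>G\<close> the integral of \<open>g p\<close> over \<open>{..a}\<close>. For almost every \<open>x\<close> the function \<open>g\<close> has
  mean zero, and then the weight satisfies \<open>w p = - G\<close> (\<open>weight_times_density\<close>). Since \<open>G' = g p\<close>, the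
  claim for this \<open>x\<close> is integration by parts: the integral of \<open>f g p\<close> is minus the integral of \<open>G f'\<close>
  (\<open>stein_identity\<close>). Two points need care.

  First, \<open>f\<close> is merely differentiable, so \<open>f'\<close> need not be Lebesgue integrable even on compact
  intervals, and \<open>f G\<close> need not be absolutely continuous. But \<open>f'\<close> is always gauge
  (Henstock--Kurzweil) integrable, and so is its product with the function \<open>G\<close> of bounded variation.
  Integration by parts thus holds for the gauge integral (\<open>by_parts_cumulative\<close>). The
  hypothesis that the expectation of \<open>w f'\<close> exists bounds one part of \<open>G f'\<close>, and this makes the gauge
  integral a Lebesgue integral (\<open>henstock_imp_lebesgue_one_sided\<close>).

  Second, the boundary terms \<open>f G\<close> must vanish at the ends of the support. By the Cauchy--Schwarz
  inequality, \<open>G\<^sup>2\<close> is at most a constant times \<open>F\<close>, and also at most a constant times \<open>1 - F\<close>. As \<open>F\<close>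
  is uniform under the conditional law and \<open>f\<^sup>2\<close> is integrable, \<open>f\<^sup>2 F\<close> tends to zero along some sequence
  of points approaching the left end, and likewise \<open>f\<^sup>2 (1 - F)\<close> at the right end
  (\<open>uniform_boundary_sequence\<close>).

  Finally the identity is integrated over \<open>x\<close> (\<open>one_sided_identity\<close>). The slice integrals of \<open>G f'\<close>
  equal those of \<open>- f g p\<close>, which are integrable over \<open>x\<close>, so the bound on one part of \<open>w f'\<close> implies a
  bound on the other part.
\<close>

section \<open>Integration by parts for gauge integrals\<close>

text \<open>
  The second mean value theorem for integrals, with the integral of \<open>f'\<close> replaced by an
  increment of \<open>f\<close>. It shows that \<open>P f'\<close> is gauge integrable even if \<open>f'\<close> is not Lebesgue
  integrable, and it already has the shape of integration by parts: the term
  \<open>(P b - P a) * f c\<close> stands for the Stieltjes integral of \<open>f\<close> against \<open>P\<close>.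
\<close>

lemma deriv_mult_mono_has_integral:
  fixes f f' P :: "real \<Rightarrow> real"
  assumes "a \<le> b"
    and der: "\<And>t. t \<in> {a..b} \<Longrightarrow> (f has_real_derivative f' t) (at t)"
    and mono: "\<And>s t. \<lbrakk>a \<le> s; s \<le> t; t \<le> b\<rbrakk> \<Longrightarrow> P s \<le> P t"
  obtains c where "c \<in> {a..b}"
    "((\<lambda>t. P t * f' t) has_integral (P b * f b - P a * f a - (P b - P a) * f c)) {a..b}"
proof -
  have ftc: "(f' has_integral (f t - f s)) {s..t}" if "a \<le> s" "s \<le> t" "t \<le> b" for s t
    using that der
    by (intro fundamental_theorem_of_calculus)
       (auto simp flip: has_real_derivative_iff_has_vector_derivative
             intro: has_field_derivative_at_within)
  from ftc[of a b] have "f' integrable_on {a..b}"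
    using \<open>a \<le> b\<close> by (auto simp: integrable_on_def)
  from second_mean_value_theorem_full[OF this \<open>a \<le> b\<close>, of P] mono
  obtain c where c: "c \<in> {a..b}"
    "((\<lambda>t. P t * f' t) has_integral (P a * integral {a..c} f' + P b * integral {c..b} f')) {a..b}"
    by blast
  have "integral {a..c} f' = f c - f a" "integral {c..b} f' = f b - f c"
    using c ftc[of a c] ftc[of c b] by (auto intro!: integral_unique)
  with c show ?thesis
    by (intro that[of c]) (auto simp: algebra_simps)
qed

text \<open>
  An interval function that is additive and bounded by the oscillation of a continuous \<open>f\<close> times
  the increment of \<open>P\<close> vanishes, because adding up short intervals on which \<open>f\<close> oscillates by
  at most \<open>e\<close> gives at most \<open>e * (P b - P a)\<close>.
\<close>

lemma additive_small_imp_zero: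
  fixes D :: "real \<Rightarrow> real \<Rightarrow> real" and f P :: "real \<Rightarrow> real"
  assumes "a \<le> b" and cont: "continuous_on {a..b} f"
    and add: "\<And>r s t. \<lbrakk>a \<le> r; r \<le> s; s \<le> t; t \<le> b\<rbrakk> \<Longrightarrow> D r t = D r s + D s t"
    and bound: "\<And>s t e. \<lbrakk>a \<le> s; s \<le> t; t \<le> b; \<And>u v. \<lbrakk>u \<in> {s..t}; v \<in> {s..t}\<rbrakk> \<Longrightarrow> \<bar>f u - f v\<bar> \<le> e\<rbrakk>
       \<Longrightarrow> \<bar>D s t\<bar> \<le> e * (P t - P s)"
  shows "D a b = 0"
proof -
  have small: "\<bar>D a b\<bar> \<le> e * (P b - P a)" if "e > 0" for e
  proof -
    have "uniformly_continuous_on {a..b} f"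
      using cont by (simp add: compact_uniformly_continuous)
    then obtain d where "d > 0"
      and d: "\<And>u v. \<lbrakk>u \<in> {a..b}; v \<in> {a..b}; dist u v < d\<rbrakk> \<Longrightarrow> dist (f u) (f v) < e"
      using \<open>e > 0\<close> unfolding uniformly_continuous_on_def by (metis dist_commute)
    have fine: "\<bar>D s t\<bar> \<le> e * (P t - P s)" if "a \<le> s" "s \<le> t" "t \<le> b" "t - s < d" for s t
    proof (rule bound[OF that(1-3)])
      fix u v assume "u \<in> {s..t}" "v \<in> {s..t}"
      then show "\<bar>f u - f v\<bar> \<le> e"
        using d[of u v] that by (auto simp: dist_real_def intro!: less_imp_le)
    qed
    \<comment> \<open>Cut off pieces of length \<open>d/2\<close> from the right; the induction avoids explicit partitions.\<close>
    have "\<bar>D s t\<bar> \<le> e * (P t - P s)" if "a \<le> s" "s \<le> t" "t \<le> b" "t - s < real (Suc n) * (d/2)" for n s t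
      using that
    proof (induction n arbitrary: t)
      case 0
      then show ?case using \<open>d > 0\<close> by (intro fine) auto
    next
      case (Suc n)
      define r where "r = max s (t - d/2)"
      have r: "s \<le> r" "r \<le> t" "t - r < d" "r - s < real (Suc n) * (d/2)"
        using Suc.prems \<open>d > 0\<close> unfolding r_def
        by (auto simp: max_def algebra_simps add_pos_nonneg)
      have "\<bar>D s r\<bar> \<le> e * (P r - P s)" using r Suc.prems by (intro Suc.IH) auto
      moreover have "\<bar>D r t\<bar> \<le> e * (P t - P r)" using r Suc.prems by (intro fine) auto
      moreover have "D s t = D s r + D r t" using r Suc.prems by (intro add) auto
      ultimately show ?case by (simp add: algebra_simps)
    qed
    moreover obtain n where "b - a < real n * (d/2)"
      using \<open>d > 0\<close> reals_Archimedean3[of "d/2"] half_gt_zero by blast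
    then have "b - a < real (Suc n) * (d/2)" using \<open>d > 0\<close> by (simp add: algebra_simps)
    ultimately show ?thesis using \<open>a \<le> b\<close> by blast
  qed
  have "((\<lambda>e. e * (P b - P a)) \<longlongrightarrow> 0 * (P b - P a)) (at_right 0)"
    by (intro tendsto_intros)
  moreover have "eventually (\<lambda>e. \<bar>D a b\<bar> \<le> e * (P b - P a)) (at_right 0)"
    using small by (auto simp: eventually_at_right_less intro: eventually_at_rightI[of 0 1])
  ultimately have "\<bar>D a b\<bar> \<le> 0 * (P b - P a)"
    by (intro tendsto_lowerbound[where F = "at_right (0::real)"]) auto
  then show ?thesis by simp
qed

text \<open>
  The error \<open>D\<close> in the formula for integration by parts is additive in the interval. On \<open>{s..t}\<close>
  the mean value form above turns it into the integral of \<open>(f - f c) * q\<close> for some \<open>c\<close> in that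
  interval, hence it is small in the sense of \<open>additive_small_imp_zero\<close> and must vanish.
\<close>

lemma by_parts_mono:
  fixes f f' P q :: "real \<Rightarrow> real"
  assumes "a \<le> b"
    and der: "\<And>t. t \<in> {a..b} \<Longrightarrow> (f has_real_derivative f' t) (at t)"
    and q_nonneg: "\<And>t. t \<in> {a..b} \<Longrightarrow> 0 \<le> q t"
    and q_int: "\<And>s t. \<lbrakk>a \<le> s; s \<le> t; t \<le> b\<rbrakk> \<Longrightarrow> (q has_integral (P t - P s)) {s..t}"
    and fq: "(\<lambda>t. f t * q t) integrable_on {a..b}"
  shows "((\<lambda>t. P t * f' t) has_integral
           (P b * f b - P a * f a - integral {a..b} (\<lambda>t. f t * q t))) {a..b}"
proof -
  have mono: "P s \<le> P t" if "a \<le> s" "s \<le> t" "t \<le> b" for s t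
    using has_integral_nonneg[OF q_int[OF that]] q_nonneg that by auto
  define D where "D s t = integral {s..t} (\<lambda>t. P t * f' t) - (P t * f t - P s * f s)
    + integral {s..t} (\<lambda>t. f t * q t)" for s t
  have Pf': "(\<lambda>t. P t * f' t) integrable_on {s..t}" if "a \<le> s" "s \<le> t" "t \<le> b" for s t
    using that by (auto intro: deriv_mult_mono_has_integral[of s t f f' P] simp: der mono integrable_on_def)
  have fq': "(\<lambda>t. f t * q t) integrable_on {s..t}" if "a \<le> s" "s \<le> t" "t \<le> b" for s t
    using fq that by (auto intro: integrable_on_subinterval)
  have "D a b = 0"
  proof (rule additive_small_imp_zero[where D = D and f = f and P = P])
    show "a \<le> b" by fact
    show "continuous_on {a..b} f"
      using der by (meson DERIV_isCont continuous_at_imp_continuous_on)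
  next
    fix r s t assume "a \<le> r" "r \<le> s" "s \<le> t" "t \<le> b"
    then show "D r t = D r s + D s t"
      unfolding D_def
      by (simp add: Pf' fq' flip: Henstock_Kurzweil_Integration.integral_combine[of r s t])
  next
    fix s t e assume st: "a \<le> s" "s \<le> t" "t \<le> b"
      and osc: "\<And>u v. \<lbrakk>u \<in> {s..t}; v \<in> {s..t}\<rbrakk> \<Longrightarrow> \<bar>f u - f v\<bar> \<le> e"
    obtain c where c: "c \<in> {s..t}"
      "((\<lambda>t. P t * f' t) has_integral (P t * f t - P s * f s - (P t - P s) * f c)) {s..t}"
      using deriv_mult_mono_has_integral[of s t f f' P] st der mono by auto
    have "D s t = integral {s..t} (\<lambda>u. f u * q u) - f c * (P t - P s)"
      unfolding D_def integral_unique[OF c(2)] by (simp add: algebra_simps)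
    also have "\<dots> = integral {s..t} (\<lambda>u. f u * q u - f c * q u)"
      using fq'[OF st] q_int[OF st] 
      by (subst Henstock_Kurzweil_Integration.integral_diff)
         (auto intro!: integrable_on_mult_right simp: integral_unique has_integral_integrable)
    finally have "D s t = integral {s..t} (\<lambda>u. f u * q u - f c * q u)" .
    also have "norm \<dots> \<le> integral {s..t} (\<lambda>u. e * q u)"
    proof (rule integral_norm_bound_integral)
      show "(\<lambda>u. f u * q u - f c * q u) integrable_on {s..t}"
        using fq'[OF st] q_int[OF st]
        by (intro Henstock_Kurzweil_Integration.integrable_diff integrable_on_mult_right)
           (auto simp: has_integral_integrable)
      show "(\<lambda>u. e * q u) integrable_on {s..t}"
        using q_int[OF st] by (intro integrable_on_mult_right) (auto simp: has_integral_integrable)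
      fix u assume u: "u \<in> {s..t}"
      have "norm (f u * q u - f c * q u) = \<bar>f u - f c\<bar> * q u"
        using q_nonneg[of u] u st by (simp add: abs_mult flip: left_diff_distrib)
      also have "\<dots> \<le> e * q u"
        using osc[OF u c(1)] q_nonneg[of u] u st by (intro mult_right_mono) auto
      finally show "norm (f u * q u - f c * q u) \<le> e * q u" .
    qed
    also have "\<dots> = e * (P t - P s)"
      using q_int[OF st] by (simp add: integral_unique)
    finally show "\<bar>D s t\<bar> \<le> e * (P t - P s)" by simp
  qed
  then have "integral {a..b} (\<lambda>t. P t * f' t)
      = P b * f b - P a * f a - integral {a..b} (\<lambda>t. f t * q t)"
    by (simp add: D_def)
  with Pf'[of a b] \<open>a \<le> b\<close> show ?thesis
    by (simp add: has_integral_iff)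
qed

section \<open>Square integrable functions on a probability space\<close>

text \<open>
  If \<open>H\<close> is uniform on \<open>(0,1)\<close>, then \<open>1/H\<close> is not integrable near \<open>H = 0\<close>, so a square
  integrable \<open>f\<close> cannot have \<open>f\<^sup>2\<close> of order \<open>1/H\<close> there. Quantitatively: on the dyadic shell
  where \<open>H\<close> lies between \<open>s/2\<close> and \<open>s\<close>, which has probability \<open>s/2\<close>, the smallest values of
  \<open>f\<^sup>2\<close> are at most of the order of the mean of \<open>f\<^sup>2\<close> over the shell. That mean is
  \<open>2 / s\<close> times an integral that tends to zero. With \<open>H\<close> a distribution or survival function, this
  gives points approaching the ends of the support at which boundary terms disappear.
\<close>

lemma (in prob_space) uniform_boundary_sequence:
  fixes H f :: "'a \<Rightarrow> real"
  assumes [measurable]: "H \<in> borel_measurable M" "f \<in> borel_measurable M" "S \<in> sets M"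
    and S: "prob S = 1"
    and unif: "\<And>s. \<lbrakk>0 < s; s < 1\<rbrakk> \<Longrightarrow> prob {x \<in> space M. H x \<le> s} = s"
    and f2: "integrable M (\<lambda>x. (f x)\<^sup>2)"
  obtains t :: "nat \<Rightarrow> 'a" where "\<And>n. t n \<in> S" "\<And>n. 0 < H (t n)"
    "(\<lambda>n. H (t n)) \<longlonglongrightarrow> 0" "(\<lambda>n. (f (t n))\<^sup>2 * H (t n)) \<longlonglongrightarrow> 0"
proof -
  define s :: "nat \<Rightarrow> real" where "s n = (1/2) ^ Suc n" for n
  have s0: "0 < s n" for n by (simp add: s_def)
  have s1: "s n < 1" for n unfolding s_def by (rule power_Suc_less_one) auto
  have s_Suc: "s (Suc n) = s n / 2" for n by (simp add: s_def)
  have s_lim: "s \<longlonglongrightarrow> 0"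
    unfolding s_def by (intro LIMSEQ_Suc LIMSEQ_power_zero) auto
  define B where "B n = {x \<in> space M. s (Suc n) < H x \<and> H x \<le> s n} \<inter> S" for n
  have [measurable]: "B n \<in> sets M" for n unfolding B_def by measurable
  have prob_B: "prob (B n) = s n / 2" for n
  proof -
    have "prob (B n) = prob {x \<in> space M. s (Suc n) < H x \<and> H x \<le> s n}"
      unfolding B_def using S by (intro measure_eq_AE) (auto simp: prob_eq_1)
    also have "{x \<in> space M. s (Suc n) < H x \<and> H x \<le> s n}
        = {x \<in> space M. H x \<le> s n} - {x \<in> space M. H x \<le> s (Suc n)}" by auto
    also have "prob \<dots> = s n - s (Suc n)"
      using s0[of n] unif[of "s n"] unif[of "s (Suc n)"] s0[of "Suc n"] s1[of n] s1[of "Suc n"]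
      by (subst finite_measure_Diff) (auto simp: s_Suc)
    finally show ?thesis by (simp add: s_Suc)
  qed
  define T where "T n = (\<integral>x. indicator (B n) x * (f x)\<^sup>2 \<partial>M)" for n
  have T_int: "integrable M (\<lambda>x. indicator (B n) x * (f x)\<^sup>2)" for n
    using integrable_mult_indicator[OF _ f2, of "B n"] by simp
  have T_lim: "T \<longlonglongrightarrow> 0"
  proof -
    have "T \<longlonglongrightarrow> (\<integral>x. 0 \<partial>M)"
      unfolding T_def
    proof (rule integral_dominated_convergence[where w = "\<lambda>x. (f x)\<^sup>2"])
      show "AE x in M. (\<lambda>n. indicator (B n) x * (f x)\<^sup>2) \<longlonglongrightarrow> 0"
      proof (rule AE_I2)
        fix x
        have "eventually (\<lambda>n. x \<notin> B n) sequentially"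
        proof (cases "H x > 0")
          case True
          then have "eventually (\<lambda>n. s n < H x) sequentially"
            using s_lim by (auto simp: order_tendsto_iff)
          then show ?thesis by eventually_elim (auto simp: B_def)
        next
          case False
          then have "x \<notin> B n" for n
            using s0[of "Suc n"] by (auto simp: B_def)
          then show ?thesis by simp
        qed
        then show "(\<lambda>n. indicator (B n) x * (f x)\<^sup>2) \<longlonglongrightarrow> 0"
          by (intro tendsto_eventually) (auto elim: eventually_mono)
      qed
    qed (use f2 in \<open>auto simp: indicator_def\<close>)
    then show ?thesis by simp
  qed
  \<comment> \<open>The extra \<open>s n\<close> gives strictness, which covers the case \<open>T n = 0\<close>.\<close>
  have "\<exists>x\<in>B n. (f x)\<^sup>2 * s n \<le> 2 * (T n + s n)" for n
  proof (rule ccontr)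
    assume none: "\<not> (\<exists>x\<in>B n. (f x)\<^sup>2 * s n \<le> 2 * (T n + s n))"
    define c where "c = 2 * (T n + s n) / s n"
    have c: "c \<le> (f x)\<^sup>2" if "x \<in> B n" for x
      using that s0[of n] none
      unfolding c_def by (auto simp: field_simps not_le intro: less_imp_le)
    have "integrable M (\<lambda>x. indicator (B n) x * c)"
      by (intro integrable_mult_left integrable_real_indicator) (auto simp: emeasure_eq_measure)
    then have "(\<integral>x. indicator (B n) x * c \<partial>M) \<le> (\<integral>x. indicator (B n) x * (f x)\<^sup>2 \<partial>M)"
      by (intro integral_mono T_int) (auto simp: indicator_def c)
    then have "prob (B n) * c \<le> T n" unfolding T_def by simp
    then have "T n + s n \<le> T n" using s0[of n] prob_B[of n] by (simp add: c_def)
    with s0[of n] show False by simp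
  qed
  then obtain t where t: "t n \<in> B n" "(f (t n))\<^sup>2 * s n \<le> 2 * (T n + s n)" for n
    by metis
  have tH: "0 < H (t n)" "H (t n) \<le> s n" for n
    using t(1)[of n] s0[of "Suc n"] by (auto simp: B_def)
  show ?thesis
  proof (rule that[of t])
    show "t n \<in> S" for n using t(1)[of n] by (simp add: B_def)
    show "0 < H (t n)" for n by (rule tH)
    show "(\<lambda>n. H (t n)) \<longlonglongrightarrow> 0"
      by (rule tendsto_sandwich[OF _ _ tendsto_const s_lim]) (auto simp: tH less_imp_le)
    have "(\<lambda>n. 2 * (T n + s n)) \<longlonglongrightarrow> 2 * (0 + 0)"
      by (intro tendsto_intros T_lim s_lim)
    then have lim: "(\<lambda>n. 2 * (T n + s n)) \<longlonglongrightarrow> 0" by simp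
    have "(f (t n))\<^sup>2 * H (t n) \<le> 2 * (T n + s n)" for n
      using t(2)[of n] mult_left_mono[OF tH(2)[of n], of "(f (t n))\<^sup>2"] by auto
    then show "(\<lambda>n. (f (t n))\<^sup>2 * H (t n)) \<longlonglongrightarrow> 0"
      using tH(1) by (intro tendsto_sandwich[OF _ _ tendsto_const lim]) (auto simp: less_imp_le)
  qed
qed

text \<open>
  The Cauchy--Schwarz inequality for \<open>g\<close> and an indicator. On half-lines \<open>B\<close> it bounds \<open>G\<^sup>2\<close>, below,
  by a multiple of \<open>F\<close> and of \<open>1 - F\<close>.
\<close>

lemma (in prob_space) square_expectation_on_event:
  fixes g :: "'a \<Rightarrow> real"
  assumes [measurable]: "g \<in> borel_measurable M" "B \<in> sets M"
    and g2: "integrable M (\<lambda>x. (g x)\<^sup>2)"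
  shows "(\<integral>x. indicator B x * g x \<partial>M)\<^sup>2 \<le> expectation (\<lambda>x. (g x)\<^sup>2) * prob B"
proof -
  have g: "integrable M g" using g2 by (rule square_integrable_imp_integrable[rotated]) simp
  define I where "I = (\<integral>x. indicator B x * g x \<partial>M)"
  have gB: "integrable M (\<lambda>x. indicator B x * g x)"
    using integrable_mult_indicator[OF _ g, of B] by simp
  \<comment> \<open>Expand the mean square of \<open>g - l * 1\<^sub>B\<close>; the best choice of \<open>l\<close> is the mean of \<open>g\<close> given \<open>B\<close>.\<close>
  have ge: "0 \<le> expectation (\<lambda>x. (g x)\<^sup>2) - 2 * l * I + l\<^sup>2 * prob B" for l
  proof -
    have iB: "integrable M (indicat_real B)" by (simp add: emeasure_eq_measure)
    have "0 \<le> expectation (\<lambda>x. (g x - l * indicator B x)\<^sup>2)" by simp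
    also have "(\<lambda>x. (g x - l * indicator B x)\<^sup>2)
        = (\<lambda>x. (g x)\<^sup>2 - 2 * l * (indicator B x * g x) + l\<^sup>2 * indicat_real B x)"
      by (auto simp: fun_eq_iff indicator_def power2_eq_square algebra_simps)
    also have "expectation \<dots> = expectation (\<lambda>x. (g x)\<^sup>2) - 2 * l * I + l\<^sup>2 * prob B"
      unfolding I_def using g2 gB iB by simp
    finally show ?thesis .
  qed
  show ?thesis
  proof (cases "prob B = 0")
    case True
    then have "AE x in M. indicator B x * g x = 0"
      by (auto simp: prob_eq_0 elim!: eventually_mono)
    then have "I = 0" unfolding I_def by (rule integral_eq_zero_AE)
    with True show ?thesis unfolding I_def by simp
  next
    case False
    then have "prob B > 0" using measure_nonneg[of M B] by linarith
    then show ?thesis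
      using ge[of "I / prob B"] unfolding I_def[symmetric]
      by (simp add: field_simps power2_eq_square)
  qed
qed

lemma integrable_mult_square_integrable:
  fixes f g :: "'a \<Rightarrow> real"
  assumes [measurable]: "f \<in> borel_measurable M" "g \<in> borel_measurable M"
    and "integrable M (\<lambda>x. (f x)\<^sup>2)" "integrable M (\<lambda>x. (g x)\<^sup>2)"
  shows "integrable M (\<lambda>x. f x * g x)"
proof (rule Bochner_Integration.integrable_bound)
  show "integrable M (\<lambda>x. (f x)\<^sup>2 + (g x)\<^sup>2)" using assms by simp
  show "AE x in M. norm (f x * g x) \<le> norm ((f x)\<^sup>2 + (g x)\<^sup>2)"
  proof (rule AE_I2)
    fix x
    have "2 * (\<bar>f x\<bar> * \<bar>g x\<bar>) \<le> (f x)\<^sup>2 + (g x)\<^sup>2"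
      using sum_squares_bound[of "\<bar>f x\<bar>" "\<bar>g x\<bar>"] by simp
    moreover have "0 \<le> \<bar>f x\<bar> * \<bar>g x\<bar>" by simp
    ultimately show "norm (f x * g x) \<le> norm ((f x)\<^sup>2 + (g x)\<^sup>2)" 
      unfolding real_norm_def abs_mult by linarith
  qed
qed measurable

section \<open>From gauge integrals on intervals to Lebesgue integrals\<close>

lemma has_integral_cumulative_diff:
  fixes q :: "real \<Rightarrow> real"
  assumes q: "integrable lborel q" and "s \<le> t"
  shows "(q has_integral ((LINT u:{..t}|lborel. q u) - (LINT u:{..s}|lborel. q u))) {s..t}"
proof -
  have int: "set_integrable lborel B q" if "B \<in> sets borel" for B
    using q that unfolding set_integrable_def by (intro integrable_mult_indicator) auto
  have "(LINT u:{s..t}|lborel. q u)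
      = (\<integral>u. indicator {..t} u *\<^sub>R q u - indicator {..s} u *\<^sub>R q u \<partial>lborel)"
    unfolding set_lebesgue_integral_def
  proof (rule integral_cong_AE)
    show "AE u in lborel. indicator {s..t} u *\<^sub>R q u
        = indicator {..t} u *\<^sub>R q u - indicator {..s} u *\<^sub>R q u"
      using AE_lborel_singleton[of s]
      by eventually_elim (use \<open>s \<le> t\<close> in \<open>auto simp: indicator_def\<close>)
  qed (use q in \<open>measurable\<close>)
  also have "\<dots> = (LINT u:{..t}|lborel. q u) - (LINT u:{..s}|lborel. q u)"
    using int[of "{..t}"] int[of "{..s}"]
    unfolding set_lebesgue_integral_def set_integrable_def by simp
  finally show ?thesis
    using set_borel_integral_eq_integral[OF int[of "{s..t}"]] by (simp add: has_integral_iff)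
qed

lemma set_integrable_continuous_mult:
  fixes f q :: "real \<Rightarrow> real"
  assumes f: "continuous_on {a..b} f" and q: "integrable lborel q"
  shows "set_integrable lborel {a..b} (\<lambda>u. f u * q u)"
proof -
  have "bounded (f ` {a..b})"
    using f by (intro compact_imp_bounded compact_continuous_image) auto
  then obtain C where C: "\<And>u. u \<in> {a..b} \<Longrightarrow> \<bar>f u\<bar> \<le> C"
    unfolding bounded_iff by fastforce
  have [measurable]: "(\<lambda>u. indicator {a..b} u *\<^sub>R f u) \<in> borel_measurable borel"
    using f by (intro borel_measurable_continuous_on_indicator) auto
  have [measurable]: "q \<in> borel_measurable borel" using q by auto
  have "integrable lborel (\<lambda>u. (indicator {a..b} u *\<^sub>R f u) * q u)"
  proof (rule Bochner_Integration.integrable_bound)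
    show "integrable lborel (\<lambda>u. \<bar>C\<bar> * q u)" using q by simp
    show "AE u in lborel. norm ((indicator {a..b} u *\<^sub>R f u) * q u) \<le> norm (\<bar>C\<bar> * q u)"
      using C by (intro AE_I2) (auto simp: indicator_def abs_mult intro!: mult_right_mono, force)
  qed measurable
  then show ?thesis by (simp add: set_integrable_def mult.assoc)
qed

text \<open>
  Split \<open>q\<close> into its positive and its negative part, so that \<open>G\<close> becomes a difference of two
  nondecreasing functions. The integral on the left
  is a gauge integral, since \<open>G f'\<close> need not be absolutely integrable.
\<close>

lemma by_parts_cumulative:
  fixes f f' q :: "real \<Rightarrow> real"
  assumes "a \<le> b"
    and der: "\<And>t. t \<in> {a..b} \<Longrightarrow> (f has_real_derivative f' t) (at t)"
    and q: "integrable lborel q"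
  defines "G \<equiv> \<lambda>t. (LINT u:{..t}|lborel. q u)"
  shows "((\<lambda>t. G t * f' t) has_integral
           (G b * f b - G a * f a - (LINT u:{a..b}|lborel. f u * q u))) {a..b}"
proof -
  have cont: "continuous_on {a..b} f"
    using der by (meson DERIV_isCont continuous_at_imp_continuous_on)
  have mono_case: "((\<lambda>t. (LINT u:{..t}|lborel. r u) * f' t) has_integral
      ((LINT u:{..b}|lborel. r u) * f b - (LINT u:{..a}|lborel. r u) * f a
        - (LINT u:{a..b}|lborel. f u * r u))) {a..b}"
    if r: "integrable lborel r" "\<And>t. 0 \<le> r t" for r
  proof -
    note fr = set_borel_integral_eq_integral[OF set_integrable_continuous_mult[OF cont r(1)]]
    show ?thesis
      unfolding fr(2)
      by (rule by_parts_mono[where q = r])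
         (use \<open>a \<le> b\<close> der r fr in \<open>auto intro: has_integral_cumulative_diff\<close>)
  qed
  define q1 where "q1 = (\<lambda>t. max 0 (q t))"
  define q2 where "q2 = (\<lambda>t. max 0 (- q t))"
  have int: "integrable lborel q1" "integrable lborel q2"
    using q by (auto simp: q1_def q2_def)
  have q_eq: "q t = q1 t - q2 t" for t by (auto simp: q1_def q2_def)
  have sint: "set_integrable lborel B q1" "set_integrable lborel B q2" if "B \<in> sets borel" for B
    using int that unfolding set_integrable_def by (intro integrable_mult_indicator; simp)+
  have G_eq: "G t = (LINT u:{..t}|lborel. q1 u) - (LINT u:{..t}|lborel. q2 u)" for t
    unfolding G_def q_eq by (intro set_integral_diff sint) auto
  have "(LINT u:{a..b}|lborel. f u * q u)
      = (LINT u:{a..b}|lborel. f u * q1 u) - (LINT u:{a..b}|lborel. f u * q2 u)"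
    unfolding q_eq right_diff_distrib
    by (intro set_integral_diff set_integrable_continuous_mult cont int)
  moreover have "q1 t \<ge> 0" "q2 t \<ge> 0" for t by (auto simp: q1_def q2_def)
  note has_integral_diff[OF mono_case[OF int(1) this(1)] mono_case[OF int(2) this(2)]]
  ultimately show ?thesis
    unfolding G_eq by (auto simp: algebra_simps intro: has_integral_eq_rhs)
qed

text \<open>
  A gauge integrable function with Lebesgue integrable negative part has a gauge integrable positive
  part, and for nonnegative functions the two notions of integral agree.
\<close>

lemma henstock_imp_lebesgue_one_sided:
  fixes h :: "real \<Rightarrow> real"
  assumes h [measurable]: "h \<in> borel_measurable borel"
    and neg: "(\<integral>\<^sup>+t. ennreal (- h t) \<partial>lborel) < \<infinity>"
    and I: "(h has_integral I) {a..b}"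
  shows "set_integrable lborel {a..b} h" "(LINT t:{a..b}|lborel. h t) = I"
proof -
  have "integrable lborel (\<lambda>t. max 0 (- h t))"
    using neg by (intro integrableI_nonneg) (auto simp: ennreal_max_0)
  then have n: "set_integrable lborel {a..b} (\<lambda>t. max 0 (- h t))"
    unfolding set_integrable_def by (intro integrable_mult_indicator) auto
  from set_borel_integral_eq_integral(1)[OF this]
  obtain J where "((\<lambda>t. max 0 (- h t)) has_integral J) {a..b}" by (auto simp: integrable_on_def)
  from has_integral_add[OF I this]
  have "((\<lambda>t. max 0 (h t)) has_integral (I + J)) {a..b}"
    by (rule has_integral_eq[rotated]) (auto simp: max_def)
  then have "(\<integral>\<^sup>+t. ennreal (max 0 (h t)) * indicator {a..b} t \<partial>lborel) = ennreal (I + J)"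
    by (intro nn_integral_has_integral_lebesgue') auto
  then have "(\<integral>\<^sup>+t. ennreal (indicator {a..b} t *\<^sub>R max 0 (h t)) \<partial>lborel) < \<infinity>"
    by (simp add: ennreal_mult' ennreal_indicator mult.commute indicator_mult_ennreal)
  then have "set_integrable lborel {a..b} (\<lambda>t. max 0 (h t))"
    unfolding set_integrable_def by (intro integrableI_nonneg) auto
  from set_integral_diff(1)[OF this n]
  show *: "set_integrable lborel {a..b} h"
    by (rule set_integrable_cong[THEN iffD1, rotated -1]) (auto simp: max_def)
  show "(LINT t:{a..b}|lborel. h t) = I"
    using set_borel_integral_eq_integral[OF *] I by (simp add: integral_unique)
qed

text \<open>
  The sets \<open>K n\<close> need not increase, so monotone convergence is not available. Since the negative part
  is integrable and the integrals over \<open>K n\<close> are bounded, Fatou's lemma makes the positive part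
  integrable; dominated convergence then identifies the integral.
\<close>

lemma integral_exhaustion_one_sided:
  fixes h :: "'a \<Rightarrow> real"
  assumes h [measurable]: "h \<in> borel_measurable M" and K [measurable]: "\<And>n. K n \<in> sets M"
    and neg: "(\<integral>\<^sup>+t. ennreal (- h t) \<partial>M) < \<infinity>"
    and exhaust: "\<And>t. h t \<noteq> 0 \<Longrightarrow> eventually (\<lambda>n. t \<in> K n) sequentially"
    and int: "\<And>n. set_integrable M (K n) h"
    and lim: "(\<lambda>n. LINT t:K n|M. h t) \<longlonglongrightarrow> L"
  shows "integrable M h" "integral\<^sup>L M h = L"
proof -
  have n_int: "integrable M (\<lambda>t. max 0 (- h t))"
    using neg by (intro integrableI_nonneg) (auto simp: ennreal_max_0)
  define N where "N = (\<integral>t. max 0 (- h t) \<partial>M)"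
  have ind_lim: "(\<lambda>n. indicator (K n) t * h t) \<longlonglongrightarrow> h t" for t
  proof (cases "h t = 0")
    case False
    from exhaust[OF this] have "eventually (\<lambda>n. indicator (K n) t * h t = h t) sequentially"
      by eventually_elim simp
    then show ?thesis by (rule tendsto_eventually)
  qed auto
  obtain C where C: "\<And>n. (LINT t:K n|M. h t) \<le> C"
    using convergentI[OF lim, THEN convergent_imp_Bseq]
    unfolding Bseq_def real_norm_def by (meson abs_le_D1)
  have p_bound: "(\<integral>\<^sup>+t. ennreal (indicator (K n) t * h t) \<partial>M) \<le> ennreal (C + N)" for n
  proof -
    have i1: "integrable M (\<lambda>t. indicator (K n) t * h t)"
      using int[of n] by (simp add: set_integrable_def)
    have "(\<integral>\<^sup>+t. ennreal (indicator (K n) t * h t) \<partial>M)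
        = (\<integral>\<^sup>+t. ennreal (max 0 (indicator (K n) t * h t)) \<partial>M)" by (simp add: ennreal_max_0)
    also have "\<dots> = ennreal (\<integral>t. max 0 (indicator (K n) t * h t) \<partial>M)"
      using i1 by (intro nn_integral_eq_integral) auto
    also have "(\<integral>t. max 0 (indicator (K n) t * h t) \<partial>M)
        \<le> (\<integral>t. indicator (K n) t * h t + max 0 (- h t) \<partial>M)"
      using i1 n_int by (intro integral_mono) (auto simp: indicator_def)
    also have "\<dots> = (LINT t:K n|M. h t) + N"
      using i1 n_int by (simp add: N_def set_lebesgue_integral_def)
    also have "\<dots> \<le> C + N" using C[of n] by simp
    finally show ?thesis by (simp add: ennreal_leI)
  qed
  have "(\<integral>\<^sup>+t. ennreal (h t) \<partial>M)
      = (\<integral>\<^sup>+t. liminf (\<lambda>n. ennreal (indicator (K n) t * h t)) \<partial>M)"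
    by (intro nn_integral_cong lim_imp_Liminf[symmetric] tendsto_ennrealI ind_lim) auto
  also have "\<dots> \<le> liminf (\<lambda>n. \<integral>\<^sup>+t. ennreal (indicator (K n) t * h t) \<partial>M)"
    by (intro nn_integral_liminf) auto
  also have "\<dots> \<le> ennreal (C + N)"
    using p_bound by (intro Liminf_le) (auto intro!: always_eventually)
  finally have "(\<integral>\<^sup>+t. ennreal (h t) \<partial>M) < \<infinity>" using le_less_trans by fastforce
  with neg show h_int: "integrable M h"
    by (auto simp: real_integrable_def)
  have "(\<lambda>n. \<integral>t. indicator (K n) t * h t \<partial>M) \<longlonglongrightarrow> integral\<^sup>L M h"
    by (rule integral_dominated_convergence[where w = "\<lambda>t. \<bar>h t\<bar>"])
       (use h_int ind_lim in \<open>auto simp: indicator_def\<close>)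
  with lim show "integral\<^sup>L M h = L"
    by (auto simp: set_lebesgue_integral_def intro: LIMSEQ_unique)
qed

section \<open>Densities positive on an open interval\<close>

locale interval_density =
  fixes p :: "real \<Rightarrow> real"
  assumes p_measurable [measurable]: "p \<in> borel_measurable borel"
    and p_nonneg: "\<And>t. 0 \<le> p t"
    and p_total: "(\<integral>\<^sup>+t. ennreal (p t) \<partial>lborel) = 1"
    and open_support: "open {t. 0 < p t}"
    and interval_support: "is_interval {t. 0 < p t}"
begin

definition law :: "real measure" where
  "law = density lborel (\<lambda>t. ennreal (p t))"

definition supp :: "real set" where
  "supp = {t. 0 < p t}"

abbreviation F :: "real \<Rightarrow> real" where
  "F \<equiv> cdf law"

sublocale law: real_distribution law
proof -
  have "prob_space law"
    by (rule prob_spaceI) (simp add: law_def emeasure_density p_total)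
  then show "real_distribution law"
    by (simp add: real_distribution_def real_distribution_axioms_def law_def)
qed

lemma supp_measurable [measurable]: "supp \<in> sets borel"
  unfolding supp_def by measurable

lemma integrable_law:
  "g \<in> borel_measurable borel \<Longrightarrow> integrable law g \<longleftrightarrow> integrable lborel (\<lambda>t. p t * g t)" for g :: "real \<Rightarrow> real"
  unfolding law_def by (subst integrable_real_density) (auto simp: p_nonneg)

lemma integral_law:
  "g \<in> borel_measurable borel \<Longrightarrow> integral\<^sup>L law g = (\<integral>t. p t * g t \<partial>lborel)" for g :: "real \<Rightarrow> real"
  unfolding law_def by (subst integral_real_density) (auto simp: p_nonneg)

lemma prob_eq_integral: "B \<in> sets borel \<Longrightarrow> law.prob B = (\<integral>u. p u * indicator B u \<partial>lborel)"
  using integral_law[of "indicator B"] by simp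

lemma AE_law_supp: "AE t in law. t \<in> supp"
  unfolding law_def supp_def by (subst AE_density) (auto simp: ennreal_less_zero_iff)

lemma prob_supp: "law.prob supp = 1"
  using AE_law_supp by (subst law.prob_eq_1) auto

text \<open>
  The density is positive on \<open>U\<close>, so a \<open>law\<close>-null \<open>U\<close> would be a Lebesgue null set, which a nonempty
  open set is not.
\<close>

lemma prob_open_pos:
  assumes "open U" "U \<noteq> {}" "U \<subseteq> supp" "U \<subseteq> B" "B \<in> sets borel"
  shows "0 < law.prob B"
proof -
  have [measurable]: "U \<in> sets borel" using assms by auto
  have "law.prob U \<noteq> 0"
  proof
    assume "law.prob U = 0"
    then have "AE t in law. t \<notin> U" by (subst (asm) law.prob_eq_0) auto
    then have "AE t in lborel. t \<notin> U"
      unfolding law_def using \<open>U \<subseteq> supp\<close>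
      by (subst (asm) AE_density) (auto simp: ennreal_less_zero_iff supp_def)
    then have "U \<in> null_sets lborel" by (subst AE_iff_null_sets) auto
    then have "negligible U"
      using negligible_iff_null_sets null_sets_completionI by blast
    with assms open_not_negligible show False by blast
  qed
  then have "0 < law.prob U" using measure_nonneg[of law U] by linarith
  also have "\<dots> \<le> law.prob B" using assms by (intro law.finite_measure_mono) auto
  finally show ?thesis .
qed

lemma prob_singleton: "law.prob {t} = 0"
proof (subst law.prob_eq_0)
  show "AE s in law. s \<notin> {t}"
    unfolding law_def using AE_lborel_singleton[of t]
    by (subst AE_density) (auto elim!: eventually_mono)
qed auto

lemma supp_ball:
  assumes "t \<in> supp"
  obtains e where "0 < e" "{t - e<..<t + e} \<subseteq> supp"
proof -
  from assms open_support obtain e where "0 < e" "ball t e \<subseteq> supp"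
    unfolding supp_def open_contains_ball by blast
  then show ?thesis by (intro that[of e]) (auto simp: ball_eq_greaterThanLessThan)
qed

lemma cdf_strict:
  assumes "s < t" "s \<in> supp \<or> t \<in> supp"
  shows "F s < F t"
proof -
  have "0 < law.prob {s<..t}"
    using assms(2)
  proof
    assume "s \<in> supp"
    then obtain e where "0 < e" "{s - e<..<s + e} \<subseteq> supp" by (rule supp_ball)
    then show ?thesis
      using \<open>s < t\<close> by (intro prob_open_pos[of "{s<..<min t (s + e)}"]) auto
  next
    assume "t \<in> supp"
    then obtain e where "0 < e" "{t - e<..<t + e} \<subseteq> supp" by (rule supp_ball)
    then show ?thesis
      using \<open>s < t\<close> by (intro prob_open_pos[of "{max s (t - e)<..<t}"]) auto
  qed
  then show ?thesis using law.cdf_diff_eq[OF \<open>s < t\<close>] by simp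
qed

lemma cdf_supp_bounds:
  assumes "t \<in> supp"
  shows "0 < F t" "F t < 1"
  using cdf_strict[of "t - 1" t] cdf_strict[of t "t + 1"] assms
    law.cdf_nonneg[of "t - 1"] law.cdf_bounded_prob[of "t + 1"] by auto

lemma cdf_surj:
  assumes "0 < s" "s < 1"
  obtains a where "F a = s"
proof -
  have cont: "isCont F t" for t by (simp add: law.isCont_cdf prob_singleton)
  have "eventually (\<lambda>t. F t < s) at_bot"
    using law.cdf_lim_at_bot \<open>0 < s\<close> by (auto simp: order_tendsto_iff)
  then obtain l where l: "F l < s" by (auto simp: eventually_at_bot_linorder)
  have "eventually (\<lambda>t. s < F t) at_top"
    using law.cdf_lim_at_top_prob \<open>s < 1\<close> by (auto simp: order_tendsto_iff)
  then obtain u where u: "s < F u" by (auto simp: eventually_at_top_linorder)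
  have "l \<le> u" using l u law.cdf_nondecreasing[of u l] by linarith
  then obtain a where "F a = s"
    using IVT[of F l s u] l u cont by auto
  then show ?thesis by (rule that)
qed

lemma F_measurable [measurable]: "F \<in> borel_measurable borel"
  by (intro borel_measurable_mono monoI law.cdf_nondecreasing)

lemma prob_greaterThan: "law.prob {t<..} = 1 - F t"
proof -
  have "law.prob {t<..} = law.prob (space law - {..t})"
    by (rule arg_cong[where f = law.prob]) auto
  also have "\<dots> = 1 - F t" unfolding cdf_def by (rule law.prob_compl) simp
  finally show ?thesis .
qed

lemma prob_atLeast: "law.prob {t..} = 1 - F t"
proof -
  have "law.prob {t..} = law.prob ({t} \<union> {t<..})"
    by (rule arg_cong[where f = law.prob]) auto
  also have "\<dots> = law.prob {t} + law.prob {t<..}"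
    by (rule law.finite_measure_Union) auto
  finally show ?thesis by (simp add: prob_singleton prob_greaterThan)
qed

text \<open>
  The probability integral transform. Up to a \<open>law\<close>-null set, the event is the half-line that ends at
  a quantile of level \<open>s\<close>, as \<open>F\<close> is strictly increasing at points of the support.
\<close>

lemma cdf_uniform:
  assumes "0 < s" "s < 1"
  shows "law.prob {t \<in> space law. F t \<le> s} = s"
proof -
  from cdf_surj[OF assms] obtain a where a: "F a = s" .
  have "law.prob {t \<in> space law. F t \<le> s} = law.prob {..a}"
  proof (rule measure_eq_AE)
    show "AE t in law. (t \<in> {t \<in> space law. F t \<le> s}) = (t \<in> {..a})"
      using AE_law_supp
    proof eventually_elim
      case (elim t)
      then show ?case
        using cdf_strict[of a t] law.cdf_nondecreasing[of t a] a by (cases "a < t") auto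
    qed
  qed auto
  with a show ?thesis by (simp add: cdf_def)
qed

lemma survival_uniform:
  assumes "0 < s" "s < 1"
  shows "law.prob {t \<in> space law. 1 - F t \<le> s} = s"
proof -
  from cdf_surj[of "1 - s"] assms obtain a where a: "F a = 1 - s" by auto
  have "law.prob {t \<in> space law. 1 - F t \<le> s} = law.prob {a..}"
  proof (rule measure_eq_AE)
    show "AE t in law. (t \<in> {t \<in> space law. 1 - F t \<le> s}) = (t \<in> {a..})"
      using AE_law_supp
    proof eventually_elim
      case (elim t)
      then show ?case
        using cdf_strict[of t a] law.cdf_nondecreasing[of a t] a by (cases "t < a") auto
    qed
  qed auto
  with a show ?thesis by (simp add: prob_atLeast)
qed

end

section \<open>The identity for a fixed value of the covariate\<close>

text \<open>
  One slice of the problem: \<open>p\<close> is the conditional density of \<open>A\<close> given \<open>X = x\<close> and \<open>g\<close> is the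
  function \<open>\<alpha> (\<cdot>, x)\<close>, whose conditional mean is zero.
\<close>

locale centred_score = interval_density +
  fixes g :: "real \<Rightarrow> real"
  assumes g_measurable [measurable]: "g \<in> borel_measurable borel"
    and g_square: "integrable lborel (\<lambda>t. p t * (g t)\<^sup>2)"
    and g_centred: "(\<integral>t. p t * g t \<partial>lborel) = 0"
begin

definition G :: "real \<Rightarrow> real" where
  "G t = (LINT u:{..t}|lborel. p u * g u)"

lemma G_measurable [measurable]: "G \<in> borel_measurable borel"
proof -
  have [measurable]: "Measurable.pred (borel \<Otimes>\<^sub>M borel) (\<lambda>w :: real \<times> real. snd w \<in> {..fst w})"
    unfolding atMost_iff by measurable
  show ?thesis
    unfolding G_def[abs_def] set_lebesgue_integral_def by measurable
qed

lemma g_square_law: "integrable law (\<lambda>t. (g t)\<^sup>2)"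
  using g_square by (subst integrable_law) auto

lemma g_law: "integrable law g"
  using law.square_integrable_imp_integrable[OF _ g_square_law] by simp

lemma pg_integrable: "integrable lborel (\<lambda>t. p t * g t)"
  using g_law by (subst (asm) integrable_law) auto

lemma set_integral_law:
  "B \<in> sets borel \<Longrightarrow> (LINT u:B|lborel. p u * g u) = (\<integral>u. indicator B u * g u \<partial>law)"
  by (subst integral_law) (auto simp: set_lebesgue_integral_def mult_ac)

text \<open>
  As \<open>g\<close> is centred, \<open>G\<close> is also a tail integral from the right. Hence \<open>G\<close> vanishes at both ends
  of the support, and the next two bounds give the rates.
\<close>

lemma G_right: "G t = - (LINT u:{t<..}|lborel. p u * g u)"
proof -
  have "G t + (LINT u:{t<..}|lborel. p u * g u) = (LINT u:{..t} \<union> {t<..}|lborel. p u * g u)"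
    unfolding G_def using pg_integrable
    by (intro set_integral_Un[symmetric])
       (auto simp: set_integrable_def intro!: integrable_mult_indicator[where 'b = real, simplified])
  also have "{..t} \<union> {t<..} = UNIV" by auto
  finally show ?thesis by (simp add: g_centred set_lebesgue_integral_def)
qed

lemma G_square_left: "(G t)\<^sup>2 \<le> (\<integral>u. (g u)\<^sup>2 \<partial>law) * F t"
  unfolding G_def cdf_def set_integral_law[OF atMost_borel]
  by (rule law.square_expectation_on_event) (auto intro: g_square_law)

lemma G_square_right: "(G t)\<^sup>2 \<le> (\<integral>u. (g u)\<^sup>2 \<partial>law) * (1 - F t)"
  unfolding G_right set_integral_law[OF greaterThan_borel] prob_greaterThan[symmetric] power2_minus
  by (rule law.square_expectation_on_event) (auto intro: g_square_law)

lemma G_outside_supp: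
  assumes "t \<notin> supp"
  shows "G t = 0"
proof -
  obtain s where s: "s \<in> supp"
    using prob_supp by (metis all_not_in_conv measure_empty zero_neq_one)
  have conv: "u \<in> supp" if "r \<in> supp" "v \<in> supp" "r \<le> u" "u \<le> v" for r u v
    using interval_support that unfolding supp_def is_interval_1 by blast
  have "law.prob {..t} = 0 \<or> law.prob {t<..} = 0"
  proof (cases "s < t")
    case True
    then have "u \<notin> {t<..}" if "u \<in> supp" for u
      using conv[OF s that, of t] assms by auto
    then have "AE u in law. u \<notin> {t<..}"
      using AE_law_supp by (auto elim: eventually_mono)
    then show ?thesis by (subst (2) law.prob_eq_0) auto
  next
    case False
    then have "u \<notin> {..t}" if "u \<in> supp" for u
      using conv[OF that s, of t] assms by auto
    then have "AE u in law. u \<notin> {..t}"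
      using AE_law_supp by (auto elim: eventually_mono)
    then show ?thesis by (subst law.prob_eq_0) auto
  qed
  then have "(G t)\<^sup>2 \<le> 0"
    using G_square_left[of t] G_square_right[of t]
    by (auto simp: cdf_def prob_greaterThan)
  then show ?thesis by simp
qed

text \<open>
  The algebraic reason for the form of the weight: the two conditional means are \<open>- G / (1 - F)\<close>
  and \<open>G / F\<close>, and their difference is \<open>- G / (F (1 - F))\<close>. Outside the support both sides are zero.
\<close>

lemma weight_times_density:
  "F t * (1 - F t) / p t *
     ((LINT u:{t<..}|law. g u) / law.prob {t<..} - (LINT u:{..t}|law. g u) / law.prob {..t}) * p t = - G t"
proof (cases "t \<in> supp")
  case True
  then have "p t \<noteq> 0" by (simp add: supp_def)
  have "(LINT u:{..t}|law. g u) = G t"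
    by (simp add: G_def set_integral_law set_lebesgue_integral_def[of law])
  moreover have "(LINT u:{t<..}|law. g u) = - G t"
    using G_right[of t] by (simp add: set_integral_law set_lebesgue_integral_def[of law])
  moreover have "law.prob {t<..} = 1 - F t" "law.prob {..t} = F t"
    by (simp_all add: prob_greaterThan cdf_def)
  ultimately show ?thesis
    using cdf_supp_bounds[OF True] \<open>p t \<noteq> 0\<close> by (simp add: divide_simps) (simp add: algebra_simps)
next
  case False
  then have "p t = 0" using p_nonneg[of t] by (simp add: supp_def)
  with False show ?thesis by (simp add: G_outside_supp)
qed

text \<open>
  Integration by parts on all of the support. It suffices that one part of \<open>G f'\<close>, here the negative
  one, has a finite integral. The boundary terms \<open>G f\<close> are at most \<open>\<surd>(K H) * \<bar>f\<bar>\<close>, where \<open>K\<close> is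
  the mean of \<open>g\<^sup>2\<close> and \<open>H = F\<close> at the left end and \<open>H = 1 - F\<close> at the right
  end, so they vanish along the sequences from \<open>uniform_boundary_sequence\<close>.
\<close>

lemma stein_identity:
  fixes f f' :: "real \<Rightarrow> real"
  assumes [measurable]: "f' \<in> borel_measurable borel"
    and der: "\<And>t. (f has_real_derivative f' t) (at t)"
    and f_square: "integrable lborel (\<lambda>t. p t * (f t)\<^sup>2)"
    and neg: "(\<integral>\<^sup>+t. ennreal (- (G t * f' t)) \<partial>lborel) < \<infinity>"
  shows "integrable lborel (\<lambda>t. G t * f' t)"
    "(\<integral>t. G t * f' t \<partial>lborel) = - (\<integral>t. p t * (f t * g t) \<partial>lborel)"
proof -
  have f_cont: "continuous_on B f" for B
    using der by (meson DERIV_isCont continuous_at_imp_continuous_on)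
  have [measurable]: "f \<in> borel_measurable borel"
    using f_cont by (rule borel_measurable_continuous_onI)
  have f2: "integrable law (\<lambda>t. (f t)\<^sup>2)" using f_square by (subst integrable_law) auto
  have fg: "integrable lborel (\<lambda>t. f t * (p t * g t))"
    using integrable_mult_square_integrable[of f law g] f2 g_square_law
    by (subst (asm) integrable_law) (auto simp: mult_ac)
  define K where "K = (\<integral>u. (g u)\<^sup>2 \<partial>law)"
  have vanish: "(\<lambda>n. G (r n) * f (r n)) \<longlonglongrightarrow> 0"
    if r: "(\<lambda>n. (f (r n))\<^sup>2 * H (r n)) \<longlonglongrightarrow> 0" and H: "\<And>t. (G t)\<^sup>2 \<le> K * H t"
    for r :: "nat \<Rightarrow> real" and H
  proof -
    have "(\<lambda>n. K * ((f (r n))\<^sup>2 * H (r n))) \<longlonglongrightarrow> K * 0" using r by (intro tendsto_intros)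
    then have lim: "(\<lambda>n. K * ((f (r n))\<^sup>2 * H (r n))) \<longlonglongrightarrow> 0" by simp
    have "(\<lambda>n. (G (r n) * f (r n))\<^sup>2) \<longlonglongrightarrow> 0"
    proof (rule tendsto_sandwich[OF _ _ tendsto_const lim])
      show "eventually (\<lambda>n. (G (r n) * f (r n))\<^sup>2 \<le> K * ((f (r n))\<^sup>2 * H (r n))) sequentially"
        using mult_right_mono[OF H zero_le_power2[of "f _"]]
        by (auto simp: power_mult_distrib mult_ac)
    qed auto
    from tendsto_real_sqrt[OF this] show ?thesis by (simp add: tendsto_rabs_zero_iff)
  qed
  obtain a where a: "\<And>n. a n \<in> supp" "(\<lambda>n. F (a n)) \<longlonglongrightarrow> 0" "(\<lambda>n. (f (a n))\<^sup>2 * F (a n)) \<longlonglongrightarrow> 0"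
    by (rule law.uniform_boundary_sequence[of "F" f supp, OF _ _ _ prob_supp cdf_uniform f2]) auto
  obtain b where b: "\<And>n. b n \<in> supp" "(\<lambda>n. 1 - F (b n)) \<longlonglongrightarrow> 0"
    "(\<lambda>n. (f (b n))\<^sup>2 * (1 - F (b n))) \<longlonglongrightarrow> 0"
    by (rule law.uniform_boundary_sequence[of "\<lambda>t. 1 - F t" f supp, OF _ _ _ prob_supp survival_uniform f2]) auto
  have a_ev: "eventually (\<lambda>n. a n < t) sequentially" if "t \<in> supp" for t
  proof -
    have "eventually (\<lambda>n. F (a n) < F t) sequentially"
      by (intro order_tendstoD(2)[OF a(2)] cdf_supp_bounds(1)[OF that])
    then show ?thesis
      by eventually_elim (use law.cdf_nondecreasing in \<open>force simp: not_le[symmetric]\<close>)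
  qed
  have b_ev: "eventually (\<lambda>n. t < b n) sequentially" if "t \<in> supp" for t
  proof -
    have "eventually (\<lambda>n. 1 - F (b n) < 1 - F t) sequentially"
      using cdf_supp_bounds(2)[OF that] by (intro order_tendstoD(2)[OF b(2)]) simp
    then show ?thesis
      by eventually_elim (use law.cdf_nondecreasing in \<open>force simp: not_le[symmetric]\<close>)
  qed
  have exhaust: "eventually (\<lambda>n. t \<in> {a n..b n}) sequentially" if "t \<in> supp" for t
    using a_ev[OF that] b_ev[OF that] by eventually_elim simp
  have sub: "set_integrable lborel {a n..b n} (\<lambda>t. G t * f' t)
      \<and> (LINT t:{a n..b n}|lborel. G t * f' t) = G (b n) * f (b n) - G (a n) * f (a n)
         - (LINT t:{a n..b n}|lborel. f t * (p t * g t))" if "a n \<le> b n" for n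
    using henstock_imp_lebesgue_one_sided[OF _ neg, folded G_def]
      by_parts_cumulative[OF that der pg_integrable, folded G_def] by auto
  have "(\<lambda>n. LINT t:{a n..b n}|lborel. f t * (p t * g t)) \<longlonglongrightarrow> (\<integral>t. f t * (p t * g t) \<partial>lborel)"
    unfolding set_lebesgue_integral_def
  proof (rule integral_dominated_convergence[where w = "\<lambda>t. \<bar>f t * (p t * g t)\<bar>"])
    show "AE t in lborel. (\<lambda>n. indicator {a n..b n} t *\<^sub>R (f t * (p t * g t))) \<longlonglongrightarrow> f t * (p t * g t)"
    proof (rule AE_I2)
      fix t
      show "(\<lambda>n. indicator {a n..b n} t *\<^sub>R (f t * (p t * g t))) \<longlonglongrightarrow> f t * (p t * g t)"
      proof (cases "t \<in> supp")
        case True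
        from exhaust[OF this]
        have "eventually (\<lambda>n. indicator {a n..b n} t *\<^sub>R (f t * (p t * g t)) = f t * (p t * g t)) sequentially"
          by eventually_elim simp
        then show ?thesis by (rule tendsto_eventually)
      next
        case False
        then have "p t = 0" using p_nonneg[of t] by (simp add: supp_def)
        then show ?thesis by simp
      qed
    qed
  qed (use fg in \<open>auto simp: indicator_def\<close>)
  then have "(\<lambda>n. G (b n) * f (b n) - G (a n) * f (a n)
         - (LINT t:{a n..b n}|lborel. f t * (p t * g t))) \<longlonglongrightarrow> 0 - 0 - (\<integral>t. f t * (p t * g t) \<partial>lborel)"
    using vanish[OF b(3)] vanish[OF a(3)] G_square_left G_square_right
    by (intro tendsto_diff) (auto simp: K_def)
  moreover have "eventually (\<lambda>n. a n \<le> b n) sequentially"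
  proof -
    from a_ev[OF a(1)[of 0]] b_ev[OF a(1)[of 0]] show ?thesis by eventually_elim simp
  qed
  then have "eventually (\<lambda>n. G (b n) * f (b n) - G (a n) * f (a n)
         - (LINT t:{a n..b n}|lborel. f t * (p t * g t)) = (LINT t:{a n..b n}|lborel. G t * f' t)) sequentially"
    by eventually_elim (use sub in auto)
  ultimately have lim: "(\<lambda>n. LINT t:{a n..b n}|lborel. G t * f' t)
      \<longlonglongrightarrow> - (\<integral>t. f t * (p t * g t) \<partial>lborel)"
    using Lim_transform_eventually by fastforce
  have int: "set_integrable lborel {a n..b n} (\<lambda>t. G t * f' t)" for n
    using sub[of n] by (cases "a n \<le> b n") (auto simp: set_integrable_def)
  have ex: "eventually (\<lambda>n. t \<in> {a n..b n}) sequentially" if "G t * f' t \<noteq> 0" for t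
    using that G_outside_supp[of t] by (intro exhaust) auto
  note * = integral_exhaustion_one_sided[where h = "\<lambda>t. G t * f' t" and K = "\<lambda>n. {a n..b n}", OF _ _ neg ex int lim]
  show "integrable lborel (\<lambda>t. G t * f' t)" by (rule *) auto
  have "(\<integral>t. G t * f' t \<partial>lborel) = - (\<integral>t. f t * (p t * g t) \<partial>lborel)" by (rule *) auto
  then show "(\<integral>t. G t * f' t \<partial>lborel) = - (\<integral>t. p t * (f t * g t) \<partial>lborel)" by (simp add: mult_ac)
qed

end

section \<open>Integration over the covariate\<close>

text \<open>
  If the integral of \<open>u\<close> is under control, then so is its negative part once its positive part is. This
  carries a one-sided bound on iterated integrals over to the other side.
\<close>

lemma nn_integral_neg_part_le:
  fixes u :: "'a \<Rightarrow> real"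
  assumes u: "integrable M u"
  shows "(\<integral>\<^sup>+t. ennreal (- u t) \<partial>M) \<le> ennreal \<bar>\<integral>t. u t \<partial>M\<bar> + (\<integral>\<^sup>+t. ennreal (u t) \<partial>M)"
proof -
  have pos: "(\<integral>\<^sup>+t. ennreal (u t) \<partial>M) = ennreal (\<integral>t. max 0 (u t) \<partial>M)"
    using nn_integral_eq_integral[of M "\<lambda>t. max 0 (u t)"] u by (simp add: ennreal_max_0)
  have neg: "(\<integral>\<^sup>+t. ennreal (- u t) \<partial>M) = ennreal (\<integral>t. max 0 (- u t) \<partial>M)"
    using nn_integral_eq_integral[of M "\<lambda>t. max 0 (- u t)"] u by (simp add: ennreal_max_0)
  have "(\<integral>t. u t \<partial>M) = (\<integral>t. max 0 (u t) - max 0 (- u t) \<partial>M)"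
    by (intro Bochner_Integration.integral_cong) (auto simp: max_def)
  also have "\<dots> = (\<integral>t. max 0 (u t) \<partial>M) - (\<integral>t. max 0 (- u t) \<partial>M)"
    using u by (intro Bochner_Integration.integral_diff) auto
  finally have "(\<integral>t. max 0 (- u t) \<partial>M) \<le> \<bar>\<integral>t. u t \<partial>M\<bar> + (\<integral>t. max 0 (u t) \<partial>M)" by linarith
  then show ?thesis
    unfolding pos neg by (simp flip: ennreal_plus add: ennreal_leI)
qed

lemma differentiable_fst_has_derivative:
  "differentiable_fst f \<Longrightarrow> ((\<lambda>t. f (t, x)) has_real_derivative deriv_fst f a x) (at a)"
  unfolding differentiable_fst_def deriv_fst_def
  by (simp add: DERIV_deriv_iff_real_differentiable)

lemma borel_measurable_fst_snd [measurable]: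
  "fst \<in> borel_measurable (borel :: (real \<times> (real ^ 'p)) measure)"
  "snd \<in> borel_measurable (borel :: (real \<times> (real ^ 'p)) measure)"
  by (intro borel_measurable_continuous_onI continuous_intros)+

text \<open>
  The partial derivative is a pointwise limit of difference quotients along \<open>1 / (n + 1)\<close>.
\<close>

lemma borel_measurable_deriv_fst:
  fixes f :: "real \<times> (real ^ 'p) \<Rightarrow> real"
  assumes [measurable]: "f \<in> borel_measurable borel" and diff: "differentiable_fst f"
  shows "(\<lambda>z. deriv_fst f (fst z) (snd z)) \<in> borel_measurable borel"
proof (rule borel_measurable_LIMSEQ_real)
  fix z :: "real \<times> (real ^ 'p)"
  have "filterlim (\<lambda>n. 1 / real (Suc n)) (at 0) sequentially"
    using LIMSEQ_inverse_real_of_nat by (auto simp: filterlim_at inverse_eq_divide)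
  from filterlim_compose[OF DERIV_D[OF differentiable_fst_has_derivative[OF diff]] this]
  show "(\<lambda>n. (f (fst z + 1 / real (Suc n), snd z) - f (fst z, snd z)) / (1 / real (Suc n)))
      \<longlonglongrightarrow> deriv_fst f (fst z) (snd z)" .
next
  fix n
  show "(\<lambda>z. (f (fst z + 1 / real (Suc n), snd z) - f (fst z, snd z)) / (1 / real (Suc n)))
      \<in> borel_measurable borel"
    by measurable
qed

locale conditional_density = prob_space M
  for M :: "'s measure" +
  fixes A :: "'s \<Rightarrow> real" and X :: "'s \<Rightarrow> real ^ 'p" and p0 :: "real \<Rightarrow> real ^ 'p \<Rightarrow> real"
  assumes A_measurable [measurable]: "A \<in> borel_measurable M"
    and X_measurable [measurable]: "X \<in> borel_measurable M"
    and cond_density: "is_cond_density M A X p0"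
    and cond_support: "\<And>x. open (cond_support p0 x) \<and> is_interval (cond_support p0 x)"
begin

abbreviation PX :: "(real ^ 'p) measure" where
  "PX \<equiv> distr M borel X"

sublocale PX: prob_space PX
  by (rule prob_space_distr) simp

sublocale joint: pair_sigma_finite "lborel :: real measure" PX ..

lemma sets_joint: "sets ((lborel :: real measure) \<Otimes>\<^sub>M PX) = sets borel"
proof -
  have "sets ((lborel :: real measure) \<Otimes>\<^sub>M PX) = sets (borel \<Otimes>\<^sub>M borel :: (real \<times> (real ^ 'p)) measure)"
    by (rule sets_pair_measure_cong) simp_all
  then show ?thesis by (simp only: borel_prod)
qed

lemma measurable_joint [simp]: "borel_measurable ((lborel :: real measure) \<Otimes>\<^sub>M PX) = borel_measurable borel"
  by (intro measurable_cong_sets sets_joint) simp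

lemma p0_nonneg: "0 \<le> p0 a x"
  using cond_density by (simp add: is_cond_density_def)

lemma p0_borel: "(\<lambda>z. p0 (fst z) (snd z)) \<in> borel_measurable borel"
proof -
  have "(\<lambda>(a, x). ennreal (p0 a x)) \<in> borel_measurable borel"
    using cond_density unfolding is_cond_density_def by (auto dest: distributed_borel_measurable)
  then have "(\<lambda>z. enn2real (case z of (a, x) \<Rightarrow> ennreal (p0 a x))) \<in> borel_measurable borel"
    by measurable
  then show ?thesis by (simp add: case_prod_beta p0_nonneg)
qed

lemma p0_measurable [measurable (raw)]:
  assumes "h \<in> borel_measurable N" "k \<in> borel_measurable N"
  shows "(\<lambda>y. p0 (h y) (k y)) \<in> borel_measurable N"
  using measurable_compose[OF borel_measurable_Pair[OF assms] p0_borel] by simp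

lemma section_density: "interval_density (\<lambda>a. p0 a x)"
  using cond_density cond_support[of x]
  by unfold_locales (auto simp: is_cond_density_def cond_support_def)

lemma joint_law:
  "distributed M (lborel \<Otimes>\<^sub>M PX) (\<lambda>\<omega>. (A \<omega>, X \<omega>)) (\<lambda>z. ennreal (p0 (fst z) (snd z)))"
  using cond_density by (simp add: is_cond_density_def case_prod_beta')

lemma integrable_joint:
  fixes \<phi> :: "real \<times> (real ^ 'p) \<Rightarrow> real"
  assumes "\<phi> \<in> borel_measurable borel"
  shows "integrable M (\<lambda>\<omega>. \<phi> (A \<omega>, X \<omega>)) \<longleftrightarrow>
    integrable (lborel \<Otimes>\<^sub>M PX) (\<lambda>(a, x). p0 a x * \<phi> (a, x))"
  using distributed_integrable[OF joint_law, of \<phi>] assms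
  by (simp add: p0_nonneg case_prod_beta')

lemma integral_joint:
  fixes \<phi> :: "real \<times> (real ^ 'p) \<Rightarrow> real"
  assumes "\<phi> \<in> borel_measurable borel"
  shows "(\<integral>\<omega>. \<phi> (A \<omega>, X \<omega>) \<partial>M) = (\<integral>(a, x). p0 a x * \<phi> (a, x) \<partial>(lborel \<Otimes>\<^sub>M PX))"
  using distributed_integral[OF joint_law, of \<phi>] assms
  by (simp add: p0_nonneg case_prod_beta')

lemma nn_integral_joint:
  fixes \<phi> :: "real \<times> (real ^ 'p) \<Rightarrow> real"
  assumes "\<phi> \<in> borel_measurable borel"
  shows "(\<integral>\<^sup>+\<omega>. ennreal (\<phi> (A \<omega>, X \<omega>)) \<partial>M)
    = (\<integral>\<^sup>+(a, x). ennreal (p0 a x * \<phi> (a, x)) \<partial>(lborel \<Otimes>\<^sub>M PX))"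
  using distributed_nn_integral[OF joint_law, of "\<lambda>z. ennreal (\<phi> z)"] assms
  by (simp add: p0_nonneg case_prod_beta' ennreal_mult')

lemma conditional_integral:
  fixes \<phi> :: "real \<times> (real ^ 'p) \<Rightarrow> real"
  assumes "\<phi> \<in> borel_measurable borel" "integrable M (\<lambda>\<omega>. \<phi> (A \<omega>, X \<omega>))"
  shows "AE x in PX. integrable lborel (\<lambda>a. p0 a x * \<phi> (a, x))"
    and "integrable PX (\<lambda>x. \<integral>a. p0 a x * \<phi> (a, x) \<partial>lborel)"
    and "(\<integral>x. (\<integral>a. p0 a x * \<phi> (a, x) \<partial>lborel) \<partial>PX) = (\<integral>\<omega>. \<phi> (A \<omega>, X \<omega>) \<partial>M)"
proof -
  have int: "integrable (lborel \<Otimes>\<^sub>M PX) (\<lambda>(a, x). p0 a x * \<phi> (a, x))"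
    using assms(2) unfolding integrable_joint[OF assms(1)] .
  show "AE x in PX. integrable lborel (\<lambda>a. p0 a x * \<phi> (a, x))"
    by (rule joint.AE_integrable_snd[OF int])
  show "integrable PX (\<lambda>x. \<integral>a. p0 a x * \<phi> (a, x) \<partial>lborel)"
    by (rule joint.integrable_snd[OF int])
  show "(\<integral>x. (\<integral>a. p0 a x * \<phi> (a, x) \<partial>lborel) \<partial>PX) = (\<integral>\<omega>. \<phi> (A \<omega>, X \<omega>) \<partial>M)"
    unfolding integral_joint[OF assms(1)] by (rule joint.integral_snd[OF int])
qed

text \<open>
  Integrating the slice means over any Borel set \<open>B\<close> gives the integral of \<open>\<phi> (A, X)\<close> over the
  event \<open>X \<in> B\<close>. This event belongs to the \<open>\<sigma>\<close>-algebra generated by \<open>X\<close>, so the integral is zero by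
  the defining property of the conditional expectation.
\<close>

lemma conditional_mean_zero:
  fixes \<phi> :: "real \<times> (real ^ 'p) \<Rightarrow> real"
  assumes [measurable]: "\<phi> \<in> borel_measurable borel"
    and int: "integrable M (\<lambda>\<omega>. \<phi> (A \<omega>, X \<omega>))"
    and zero: "AE \<omega> in M. real_cond_exp M (vimage_algebra (space M) X borel) (\<lambda>\<omega>. \<phi> (A \<omega>, X \<omega>)) \<omega> = 0"
  shows "AE x in PX. (\<integral>a. p0 a x * \<phi> (a, x) \<partial>lborel) = 0"
proof (rule PX.density_zero)
  show "integrable PX (\<lambda>x. \<integral>a. p0 a x * \<phi> (a, x) \<partial>lborel)"
    by (rule conditional_integral) (auto intro: int)
  fix B assume "B \<in> sets PX"
  then have B [measurable]: "B \<in> sets borel" by simp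
  define S where "S = vimage_algebra (space M) X borel"
  have sub: "subalgebra M S"
    unfolding subalgebra_def S_def by (auto simp: sets_vimage_algebra2)
  interpret fin: finite_measure_subalgebra M S
    by unfold_locales (rule sub)
  let ?C = "X -` B \<inter> space M"
  have C: "?C \<in> sets S" unfolding S_def using B by (rule in_vimage_algebra)
  have intB: "integrable M (\<lambda>\<omega>. indicator B (X \<omega>) * \<phi> (A \<omega>, X \<omega>))"
    using int by (rule Bochner_Integration.integrable_bound) (auto simp: indicator_def)
  have "(LINT x:B|PX. \<integral>a. p0 a x * \<phi> (a, x) \<partial>lborel)
      = (\<integral>x. (\<integral>a. p0 a x * (indicator B x * \<phi> (a, x)) \<partial>lborel) \<partial>PX)"
    unfolding set_lebesgue_integral_def
    by (intro Bochner_Integration.integral_cong) (auto simp: indicator_def)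
  also have "\<dots> = (\<integral>\<omega>. indicator B (X \<omega>) * \<phi> (A \<omega>, X \<omega>) \<partial>M)"
    using conditional_integral(3)[of "\<lambda>z. indicator B (snd z) * \<phi> z"] intB
    by simp
  also have "\<dots> = (LINT \<omega>:?C|M. \<phi> (A \<omega>, X \<omega>))"
    unfolding set_lebesgue_integral_def
    by (intro Bochner_Integration.integral_cong) (auto simp: indicator_def)
  also have "\<dots> = (LINT \<omega>:?C|M. real_cond_exp M S (\<lambda>\<omega>. \<phi> (A \<omega>, X \<omega>)) \<omega>)"
    by (rule fin.real_cond_exp_intA[OF int C])
  also have "\<dots> = 0"
    unfolding set_lebesgue_integral_def
    by (rule integral_eq_zero_AE) (use zero in \<open>auto simp: S_def\<close>)
  finally show "(LINT x:B|PX. \<integral>a. p0 a x * \<phi> (a, x) \<partial>lborel) = 0" .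
qed

lemma borel_measurable_weight:
  fixes \<alpha> :: "real \<times> (real ^ 'p) \<Rightarrow> real"
  assumes [measurable]: "\<alpha> \<in> borel_measurable borel"
  shows "(\<lambda>z. weight p0 \<alpha> (fst z) (snd z)) \<in> borel_measurable borel"
proof -
  have prob_eq: "measure (cond_law p0 x) B = (\<integral>u. indicator B u * p0 u x \<partial>lborel)" if "B \<in> sets borel" for x B
    using interval_density.prob_eq_integral[OF section_density that]
    by (simp add: interval_density.law_def[OF section_density] cond_law_def mult.commute)
  have mean_eq: "(LINT u:B|cond_law p0 x. \<alpha> (u, x)) = (\<integral>u. indicator B u * (p0 u x * \<alpha> (u, x)) \<partial>lborel)"
    if "B \<in> sets borel" for x B
    using interval_density.integral_law[OF section_density, of "\<lambda>u. indicator B u * \<alpha> (u, x)" x] that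
    by (simp add: interval_density.law_def[OF section_density] cond_law_def set_lebesgue_integral_def mult_ac)
  have [measurable]: "Measurable.pred (borel \<Otimes>\<^sub>M borel) (\<lambda>w :: (real \<times> (real ^ 'p)) \<times> real. snd w \<in> {..fst (fst w)})"
    "Measurable.pred (borel \<Otimes>\<^sub>M borel) (\<lambda>w :: (real \<times> (real ^ 'p)) \<times> real. snd w \<in> {fst (fst w)<..})"
    unfolding atMost_iff greaterThan_iff by measurable
  show ?thesis
    unfolding weight_def cond_cdf_def cdf_def cond_mean_on_def
    by (simp only: prob_eq mean_eq atMost_borel greaterThan_borel) measurable
qed

text \<open>
  By Fubini the one-sided bound on \<open>Z\<close> holds in almost every slice, where \<open>stein_identity\<close> makes
  \<open>p0 Z = - G f'\<close> integrable with the integral \<open>k\<close> of \<open>p0 f \<alpha>\<close>. As \<open>k\<close> is integrable over \<open>x\<close>, the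
  other part of \<open>Z\<close> has a finite expectation too, and integrating over \<open>x\<close> gives the identity.
\<close>

lemma one_sided_identity:
  fixes \<alpha> f :: "real \<times> (real ^ 'p) \<Rightarrow> real"
  assumes \<alpha>R: "\<alpha> \<in> R_set M A X" and fH: "f \<in> H_space M A X" and diff: "differentiable_fst f"
  defines "Z \<equiv> \<lambda>z. weight p0 \<alpha> (fst z) (snd z) * deriv_fst f (fst z) (snd z)"
  assumes fin: "(\<integral>\<^sup>+\<omega>. ennreal (Z (A \<omega>, X \<omega>)) \<partial>M) < \<infinity>"
  shows "integrable M (\<lambda>\<omega>. Z (A \<omega>, X \<omega>))"
    and "H_inner M A X f \<alpha> = (\<integral>\<omega>. Z (A \<omega>, X \<omega>) \<partial>M)"
proof -
  have [measurable]: "\<alpha> \<in> borel_measurable borel" "f \<in> borel_measurable borel"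
    and \<alpha>2: "integrable M (\<lambda>\<omega>. (\<alpha> (A \<omega>, X \<omega>))\<^sup>2)" and f2: "integrable M (\<lambda>\<omega>. (f (A \<omega>, X \<omega>))\<^sup>2)"
    using \<alpha>R fH by (auto simp: R_set_def H_space_def)
  have f\<alpha>: "integrable M (\<lambda>\<omega>. f (A \<omega>, X \<omega>) * \<alpha> (A \<omega>, X \<omega>))"
    by (rule integrable_mult_square_integrable[OF _ _ f2 \<alpha>2]) measurable
  have \<alpha>1: "integrable M (\<lambda>\<omega>. \<alpha> (A \<omega>, X \<omega>))"
    by (rule square_integrable_imp_integrable[OF _ \<alpha>2]) measurable
  note [measurable] = borel_measurable_weight borel_measurable_deriv_fst[OF _ diff]
  have Z [measurable]: "Z \<in> borel_measurable borel" unfolding Z_def by measurable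
  define h where "h = (\<lambda>(a, x). p0 a x * Z (a, x))"
  have h [measurable]: "h \<in> borel_measurable borel"
    unfolding h_def case_prod_beta' using p0_borel by simp
  define k where "k x = (\<integral>a. p0 a x * (f (a, x) * \<alpha> (a, x)) \<partial>lborel)" for x
  note k = conditional_integral[of "\<lambda>z. f z * \<alpha> z", simplified, OF f\<alpha>, folded k_def]
  have nn_integral_h: "integral\<^sup>N (lborel \<Otimes>\<^sub>M PX) (\<lambda>z. ennreal (h z)) = (\<integral>\<^sup>+\<omega>. ennreal (Z (A \<omega>, X \<omega>)) \<partial>M)"
    by (simp add: nn_integral_joint h_def case_prod_beta')
  have iterated: "(\<integral>\<^sup>+x. (\<integral>\<^sup>+a. ennreal (g (a, x)) \<partial>lborel) \<partial>PX)
      = integral\<^sup>N (lborel \<Otimes>\<^sub>M PX) (\<lambda>z. ennreal (g z))"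
    if [measurable]: "g \<in> borel_measurable borel" for g :: "real \<times> (real ^ 'p) \<Rightarrow> real"
    using joint.nn_integral_snd[of "\<lambda>z. ennreal (g z)"] by simp
  have fin_h: "(\<integral>\<^sup>+x. (\<integral>\<^sup>+a. ennreal (h (a, x)) \<partial>lborel) \<partial>PX) < \<infinity>"
    using fin by (simp add: iterated[OF h] nn_integral_h)
  have "AE x in PX. (\<integral>\<^sup>+a. ennreal (h (a, x)) \<partial>lborel) \<noteq> \<infinity>"
    using fin_h by (intro nn_integral_PInf_AE) auto
  moreover have "AE x in PX. integrable lborel (\<lambda>a. p0 a x * (\<alpha> (a, x))\<^sup>2)"
    using conditional_integral(1)[of "\<lambda>z. (\<alpha> z)\<^sup>2"] \<alpha>2 by simp
  moreover have "AE x in PX. integrable lborel (\<lambda>a. p0 a x * (f (a, x))\<^sup>2)"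
    using conditional_integral(1)[of "\<lambda>z. (f z)\<^sup>2"] f2 by simp
  moreover have "AE x in PX. (\<integral>a. p0 a x * \<alpha> (a, x) \<partial>lborel) = 0"
    using \<alpha>R by (intro conditional_mean_zero \<alpha>1) (auto simp: R_set_def)
  ultimately have slice: "AE x in PX. integrable lborel (\<lambda>a. h (a, x)) \<and> (\<integral>a. h (a, x) \<partial>lborel) = k x"
  proof eventually_elim
    case (elim x)
    interpret interval_density "\<lambda>a. p0 a x" by (rule section_density)
    interpret centred_score "\<lambda>a. p0 a x" "\<lambda>a. \<alpha> (a, x)"
      using elim by unfold_locales auto
    have law_eq: "law = cond_law p0 x" by (simp add: law_def cond_law_def)
    have "weight p0 \<alpha> a x * p0 a x = - G a" for a
      using weight_times_density[of a]
      by (simp only: weight_def cond_cdf_def cond_mean_on_def law_eq)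
    moreover have "h (a, x) = (weight p0 \<alpha> a x * p0 a x) * deriv_fst f a x" for a
      by (simp add: h_def Z_def)
    ultimately have h_eq: "h (a, x) = - (G a * deriv_fst f a x)" for a
      by simp
    have fin_x: "(\<integral>\<^sup>+t. ennreal (- (G t * deriv_fst f t x)) \<partial>lborel) < \<infinity>"
      using elim by (simp add: h_eq less_top)
    have m: "(\<lambda>a. deriv_fst f a x) \<in> borel_measurable borel"
      using measurable_compose[OF _ borel_measurable_deriv_fst[OF \<open>f \<in> borel_measurable borel\<close> diff], of "\<lambda>a. (a, x)" borel] by simp
    have f2_x: "integrable lborel (\<lambda>a. p0 a x * (f (a, x))\<^sup>2)" using elim by simp
    note stein = stein_identity[OF m differentiable_fst_has_derivative[OF diff] f2_x fin_x]
    show ?case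
      using stein by (simp add: h_eq k_def)
  qed
  have "(\<integral>\<^sup>+x. (\<integral>\<^sup>+a. ennreal (- h (a, x)) \<partial>lborel) \<partial>PX)
      \<le> (\<integral>\<^sup>+x. ennreal \<bar>k x\<bar> + (\<integral>\<^sup>+a. ennreal (h (a, x)) \<partial>lborel) \<partial>PX)"
  proof (rule nn_integral_mono_AE)
    show "AE x in PX. (\<integral>\<^sup>+a. ennreal (- h (a, x)) \<partial>lborel)
        \<le> ennreal \<bar>k x\<bar> + (\<integral>\<^sup>+a. ennreal (h (a, x)) \<partial>lborel)"
      using slice
    proof eventually_elim
      case (elim x)
      then show ?case using nn_integral_neg_part_le[of lborel "\<lambda>a. h (a, x)"] by simp
    qed
  qed
  also have "\<dots> = (\<integral>\<^sup>+x. ennreal \<bar>k x\<bar> \<partial>PX) + (\<integral>\<^sup>+x. (\<integral>\<^sup>+a. ennreal (h (a, x)) \<partial>lborel) \<partial>PX)"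
    using k(2) by (intro nn_integral_add) auto
  also have "\<dots> < \<infinity>"
    using k(2) fin_h by (simp add: integrable_iff_bounded)
  finally have fin_neg: "(\<integral>\<^sup>+x. (\<integral>\<^sup>+a. ennreal (- h (a, x)) \<partial>lborel) \<partial>PX) < \<infinity>" .
  have h_int: "integrable (lborel \<Otimes>\<^sub>M PX) h"
    using fin_h fin_neg h iterated[OF h] iterated[OF borel_measurable_uminus[OF h]]
    by (auto simp: real_integrable_def)
  then show Z_int: "integrable M (\<lambda>\<omega>. Z (A \<omega>, X \<omega>))"
    using integrable_joint[OF Z] by (simp add: h_def)
  have "(\<integral>\<omega>. Z (A \<omega>, X \<omega>) \<partial>M) = (\<integral>x. (\<integral>a. h (a, x) \<partial>lborel) \<partial>PX)"
    using conditional_integral(3)[OF Z Z_int] by (simp add: h_def)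
  also have "\<dots> = (\<integral>x. k x \<partial>PX)"
  proof (rule integral_cong_AE)
    show "AE x in PX. (\<integral>a. h (a, x) \<partial>lborel) = k x" using slice by eventually_elim simp
    show "(\<lambda>x. \<integral>a. h (a, x) \<partial>lborel) \<in> borel_measurable PX"
      using conditional_integral(2)[OF Z Z_int] by (auto simp: h_def)
    show "k \<in> borel_measurable PX" using k(2) by auto
  qed
  finally show "H_inner M A X f \<alpha> = (\<integral>\<omega>. Z (A \<omega>, X \<omega>) \<partial>M)"
    unfolding H_inner_def k(3) by simp
qed

end

text \<open>
  Replacing \<open>f\<close> by \<open>- f\<close> exchanges the positive and the negative part of the integrand, so the
  one-sided version covers both ways in which the expectation may exist.
\<close>

theorem theorem1:
  fixes M :: "'s measure"
    and Y A :: "'s \<Rightarrow> real"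
    and X :: "'s \<Rightarrow> real ^ 'p"
    and p0 :: "real \<Rightarrow> real ^ 'p \<Rightarrow> real"
    and \<alpha> :: "real \<times> (real ^ 'p) \<Rightarrow> real"
  assumes "prob_space M"
    and "Y \<in> borel_measurable M" and "A \<in> borel_measurable M" and "X \<in> borel_measurable M"
    and "is_cond_density M A X p0"
    and "\<And>x. open (cond_support p0 x) \<and> is_interval (cond_support p0 x)"
    and "\<alpha> \<in> R_set M A X"
  shows "\<forall>f \<in> H_space M A X. differentiable_fst f \<longrightarrow>
           expectation_exists M (\<lambda>\<omega>. weight p0 \<alpha> (A \<omega>) (X \<omega>) * deriv_fst f (A \<omega>) (X \<omega>)) \<longrightarrow>
           integrable M (\<lambda>\<omega>. weight p0 \<alpha> (A \<omega>) (X \<omega>) * deriv_fst f (A \<omega>) (X \<omega>)) \<and>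
           H_inner M A X f \<alpha> =
             (\<integral>\<omega>. weight p0 \<alpha> (A \<omega>) (X \<omega>) * deriv_fst f (A \<omega>) (X \<omega>) \<partial>M)"
proof (intro ballI impI)
  interpret prob_space M by fact
  interpret conditional_density M A X p0
    using assms by unfold_locales auto
  fix f assume fH: "f \<in> H_space M A X" and diff: "differentiable_fst f"
    and ex: "expectation_exists M (\<lambda>\<omega>. weight p0 \<alpha> (A \<omega>) (X \<omega>) * deriv_fst f (A \<omega>) (X \<omega>))"
  define Z where "Z \<omega> = weight p0 \<alpha> (A \<omega>) (X \<omega>) * deriv_fst f (A \<omega>) (X \<omega>)" for \<omega>
  from ex consider "(\<integral>\<^sup>+ \<omega>. ennreal (Z \<omega>) \<partial>M) < \<infinity>" | "(\<integral>\<^sup>+ \<omega>. ennreal (- Z \<omega>) \<partial>M) < \<infinity>"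
    unfolding expectation_exists_def Z_def by blast
  then have "integrable M Z \<and> H_inner M A X f \<alpha> = integral\<^sup>L M Z"
  proof cases
    case 1
    then show ?thesis
      using one_sided_identity[OF assms(7) fH diff] by (simp add: Z_def[abs_def])
  next
    case 2
    have fH': "(\<lambda>z. - f z) \<in> H_space M A X"
      using fH by (simp add: H_space_def)
    have diff': "differentiable_fst (\<lambda>z. - f z)"
      using diff by (auto simp: differentiable_fst_def)
    have deriv: "deriv_fst (\<lambda>z. - f z) a x = - deriv_fst f a x" for a x
      using DERIV_imp_deriv[OF DERIV_minus[OF differentiable_fst_has_derivative[OF diff]]]
      by (simp add: deriv_fst_def)
    have "integrable M (\<lambda>\<omega>. - Z \<omega>)" "H_inner M A X (\<lambda>z. - f z) \<alpha> = (\<integral>\<omega>. - Z \<omega> \<partial>M)"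
      using one_sided_identity[OF assms(7) fH' diff'] 2 by (simp_all add: Z_def deriv)
    then show ?thesis by (simp add: H_inner_def)
  qed
  then show "integrable M (\<lambda>\<omega>. weight p0 \<alpha> (A \<omega>) (X \<omega>) * deriv_fst f (A \<omega>) (X \<omega>)) \<and>
           H_inner M A X f \<alpha> =
             (\<integral>\<omega>. weight p0 \<alpha> (A \<omega>) (X \<omega>) * deriv_fst f (A \<omega>) (X \<omega>) \<partial>M)"
    by (simp add: Z_def[abs_def])
qed

end
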